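(* Let $\delta_1=\mathrm{span}\{\frac{i}{\sqrt2}\sigma_1,\frac{i}{\sqrt2}\sigma_2\}\subset\mathfrak{su}(2)$, let $\widetilde{\mathcal{C}}=C\frac{i}{\sqrt2}\sigma_3$ with $C\in\mathbb{R}$, and let $\widetilde{V}:\mathbb{R}\to\delta_1$ be a sub-Riemannian Lie quadratic, i.e. a smooth function satisfying $$\dddot{\widetilde{V}}=\big[[\dot{\widetilde{V}},\widetilde{V}],\widetilde{V}\big]+[\widetilde{\mathcal{C}},\widetilde{V}].$$ Suppose $\widetilde{V}(t)\ne0$ for all $t$ and $c_1=\langle\ddot{\widetilde{V}},\widetilde{V}\rangle-\frac12\langle\dot{\widetilde{V}},\dot{\widetilde{V}}\rangle>0$. Put $q(t)=\|\widetilde{V}(t)\|$ and $\alpha_+(\widetilde{V})=\lim_{t\to\infty}\widetilde{V}(t)/\|\widetilde{V}(t)\|$. Then, as $r\to+\infty$, $$\widetilde{V}(r)=q(r)\,\alpha_+(\widetilde{V})-q(r)\int_r^\infty\frac{1}{2q(t)^2}\,dt\,\big[\widetilde{\mathcal{C}},\alpha_+(\widetilde{V})\big]+\mathcal{O}(r^{-4}).$$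
   Context: $\sigma_1,\sigma_2,\sigma_3$ are the Pauli matrices. The inner product on $\mathfrak{su}(2)$ is the bi-invariant one $\langle X,Y\rangle=-\mathrm{tr}(XY)$, for which $\frac{i}{\sqrt2}\sigma_1,\frac{i}{\sqrt2}\sigma_2,\frac{i}{\sqrt2}\sigma_3$ are orthonormal, and $\|X\|=\langle X,X\rangle^{1/2}$. The quantity $c_1$ is constant in $t$, and the limit $\alpha_+(\widetilde{V})$ exists under the stated assumptions. A term $\mathcal{O}(r^{-4})$ denotes an $\mathfrak{su}(2)$-valued function $E(r)$ with $\|E(r)\|\le c\,r^{-4}$ for some $c>0$ and all sufficiently large $r$. *)

theory Defs
  imports "HOL-Analysis.Analysis"
begin

type_synonym cmat2 = "complex ^ 2 ^ 2"

definition pauli1 :: cmat2 where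
  "pauli1 = vector [vector [0, 1], vector [1, 0]]"

definition pauli2 :: cmat2 where
  "pauli2 = vector [vector [0, - \<i>], vector [\<i>, 0]]"

definition pauli3 :: cmat2 where
  "pauli3 = vector [vector [1, 0], vector [0, - 1]]"

definition su2_of_pauli :: "cmat2 \<Rightarrow> cmat2" where
  "su2_of_pauli S = map_matrix (\<lambda>z. \<i> / of_real (sqrt 2) * z) S"

definition su2 :: "cmat2 set" where
  "su2 = {X. transpose (map_matrix cnj X) = - X \<and> trace X = 0}"

definition lie_bracket :: "cmat2 \<Rightarrow> cmat2 \<Rightarrow> cmat2" where
  "lie_bracket X Y = X ** Y - Y ** X"

(* tr(XY) is real for X, Y in su2, so Re only adjusts the type. *)
definition su2_inner :: "cmat2 \<Rightarrow> cmat2 \<Rightarrow> real" where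
  "su2_inner X Y = - Re (trace (X ** Y))"

definition su2_norm :: "cmat2 \<Rightarrow> real" where
  "su2_norm X = sqrt (su2_inner X X)"

lemmas pauli_defs = pauli1_def pauli2_def pauli3_def

lemma su2_basis_in_su2:
  "su2_of_pauli pauli1 \<in> su2" "su2_of_pauli pauli2 \<in> su2" "su2_of_pauli pauli3 \<in> su2"
  by (simp_all add: su2_def su2_of_pauli_def pauli_defs transpose_def vec_eq_iff forall_2
      trace_def sum_2)

lemma su2_basis_orthonormal:
  "su2_inner (su2_of_pauli pauli1) (su2_of_pauli pauli1) = 1"
  "su2_inner (su2_of_pauli pauli2) (su2_of_pauli pauli2) = 1"
  "su2_inner (su2_of_pauli pauli3) (su2_of_pauli pauli3) = 1"
  "su2_inner (su2_of_pauli pauli1) (su2_of_pauli pauli2) = 0"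
  "su2_inner (su2_of_pauli pauli1) (su2_of_pauli pauli3) = 0"
  "su2_inner (su2_of_pauli pauli2) (su2_of_pauli pauli3) = 0"
  by (simp_all add: su2_inner_def su2_of_pauli_def pauli_defs trace_def sum_2
      matrix_matrix_mult_def flip: of_real_mult)

(* The real linear span. *)
definition delta1 :: "cmat2 set" where
  "delta1 = span {su2_of_pauli pauli1, su2_of_pauli pauli2}"

definition C_tilde :: "real \<Rightarrow> cmat2" where
  "C_tilde C = C *\<^sub>R su2_of_pauli pauli3"

definition curve_deriv :: "(real \<Rightarrow> cmat2) \<Rightarrow> real \<Rightarrow> cmat2" where
  "curve_deriv V = (\<lambda>t. vector_derivative V (at t))"

definition smooth_curve :: "(real \<Rightarrow> cmat2) \<Rightarrow> bool" where
  "smooth_curve V \<longleftrightarrow> (\<forall>n t. (curve_deriv ^^ n) V differentiable at t)"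

definition sub_riemannian_lie_quadratic :: "real \<Rightarrow> (real \<Rightarrow> cmat2) \<Rightarrow> bool" where
  "sub_riemannian_lie_quadratic C V \<longleftrightarrow>
     (\<forall>t. V t \<in> delta1) \<and> smooth_curve V \<and>
     (\<forall>t. (curve_deriv ^^ 3) V t =
            lie_bracket (lie_bracket (curve_deriv V t) (V t)) (V t)
            + lie_bracket (C_tilde C) (V t))"

(* Constant in t when V is a sub-Riemannian Lie quadratic. *)
definition lq_c1 :: "(real \<Rightarrow> cmat2) \<Rightarrow> real \<Rightarrow> real" where
  "lq_c1 V t = su2_inner ((curve_deriv ^^ 2) V t) (V t)
               - 1/2 * su2_inner (curve_deriv V t) (curve_deriv V t)"

definition alpha_plus :: "(real \<Rightarrow> cmat2) \<Rightarrow> cmat2" where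
  "alpha_plus V = Lim at_top (\<lambda>t. V t /\<^sub>R su2_norm (V t))"

definition su2_bigo :: "(real \<Rightarrow> cmat2) \<Rightarrow> (real \<Rightarrow> real) \<Rightarrow> bool" where
  "su2_bigo E g \<longleftrightarrow> (\<forall>r. E r \<in> su2) \<and> (\<exists>c>0. \<forall>\<^sub>F r in at_top. su2_norm (E r) \<le> c * g r)"

end

theory Submission
  imports Defs "HOL-Real_Asymp.Real_Asymp"
begin

text \<open>
  In complex coordinates on \<open>delta1\<close> the equation reads \<open>z''' = - i k z\<close> with
  \<open>k = 2 \<omega> + \<kappa>\<close>, \<open>\<omega> = Im (cnj z * z')\<close> and \<open>\<kappa> = sqrt 2 * C\<close>. Conservation of
  \<open>|z''|^2 + k^2 / 2\<close> bounds \<open>z''\<close> and \<open>\<omega>\<close>, so \<open>|z|\<close> grows at most quadratically, and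
  \<open>c1 > 0\<close> forces it to grow at least quadratically. The direction \<open>v = z / |z|\<close> satisfies
  \<open>v' = i (\<omega> / |z|^2) v\<close>, hence converges. Since \<open>\<omega> = - \<kappa> / 2 + k / 2\<close>, the claim
  is that \<open>k\<close> contributes only \<open>O(r^-6)\<close> to the angle. This is an effect of oscillation:
  \<open>k'' = 2 g - 2 k |z|^2\<close> with \<open>g = Im (cnj z' * z'') = O(r)\<close>, so \<open>k / |z|^2\<close> equals
  \<open>- k'' / (2 |z|^4)\<close> up to \<open>O(r^-7)\<close>, and the latter is integrated by parts using only
  \<open>k' = O(r^2)\<close>.
\<close>

section \<open>Growth and decay obtained from bounds on derivatives\<close>

lemma norm_diff_le_primitive:
  fixes f :: "real \<Rightarrow> 'a::real_normed_vector"
  assumes "a \<le> b"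
    and "\<And>t. a \<le> t \<Longrightarrow> (f has_vector_derivative f' t) (at t)"
    and "\<And>t. a \<le> t \<Longrightarrow> (F has_real_derivative F' t) (at t)"
    and "\<And>t. a \<le> t \<Longrightarrow> norm (f' t) \<le> F' t"
  shows "norm (f b - f a) \<le> F b - F a"
proof (cases "a < b")
  case True
  show ?thesis
  proof (rule differentiable_bound_general[OF True])
    show "continuous_on {a..b} f"
      by (rule continuous_on_vector_derivative)
         (auto intro: has_vector_derivative_at_within assms(2))
    show "continuous_on {a..b} F"
      using assms(3) by (meson DERIV_continuous_on atLeastAtMost_iff has_field_derivative_at_within)
    show "(f has_vector_derivative f' x) (at x)" if "a < x" "x < b" for x
      using assms(2) that by simp
    show "(F has_vector_derivative F' x) (at x)" if "a < x" "x < b" for x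
      using assms(3) that by (simp add: has_real_derivative_iff_has_vector_derivative)
    show "norm (f' x) \<le> F' x" if "a < x" "x < b" for x
      using assms(4) that by simp
  qed
qed (use assms(1) in auto)

lemma eventually_at_top_bound:
  fixes g :: "real \<Rightarrow> real"
  assumes "f \<in> O(g)"
  obtains K T where "K > 0" "T \<ge> 1" "\<And>t. t \<ge> T \<Longrightarrow> norm (f t) \<le> K * norm (g t)"
proof -
  from assms obtain K where K: "K > 0" "eventually (\<lambda>t. norm (f t) \<le> K * norm (g t)) at_top"
    by (elim landau_o.bigE)
  then obtain T where "\<And>t. t \<ge> T \<Longrightarrow> norm (f t) \<le> K * norm (g t)"
    by (auto simp: eventually_at_top_linorder)
  with K show ?thesis by (intro that[of K "max T 1"]) auto
qed

text \<open>Comparison with \<open>K * t ^ Suc m\<close>: its derivative carries a factor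
  \<open>Suc m\<close> of at least 1, so it dominates \<open>f'\<close> without dividing the
  constant. The value at \<open>T\<close> is absorbed because \<open>t ^ Suc m\<close> is at least
  1.\<close>

lemma growth_from_derivative:
  fixes f :: "real \<Rightarrow> 'a::real_normed_vector"
  assumes "\<And>t. (f has_vector_derivative f' t) (at t)"
    and "(\<lambda>t. norm (f' t)) \<in> O(\<lambda>t. t ^ m)"
  shows "(\<lambda>t. norm (f t)) \<in> O(\<lambda>t. t ^ Suc m)"
proof -
  obtain K T where KT: "K > 0" "T \<ge> 1" "\<And>t. t \<ge> T \<Longrightarrow> norm (norm (f' t)) \<le> K * norm (t ^ m)"
    using eventually_at_top_bound[OF assms(2)] by blast
  have "norm (f t) \<le> (norm (f T) + K) * t ^ Suc m" if "t \<ge> T" for t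
  proof -
    have "norm (f t - f T) \<le> K * t ^ Suc m - K * T ^ Suc m"
    proof (rule norm_diff_le_primitive[OF that])
      show "((\<lambda>t. K * t ^ Suc m) has_real_derivative K * (real (Suc m) * t ^ m)) (at t)" for t
        using DERIV_cmult[OF DERIV_pow[of "Suc m" t], of K] by simp
      show "norm (f' t) \<le> K * (real (Suc m) * t ^ m)" if "T \<le> t" for t
      proof -
        have "norm (f' t) \<le> K * (1 * t ^ m)"
          using KT(3)[OF that] KT(2) that by simp
        also have "\<dots> \<le> K * (real (Suc m) * t ^ m)"
          using KT that by (intro mult_left_mono mult_right_mono) auto
        finally show ?thesis .
      qed
    qed (rule assms)
    moreover have "norm (f t) \<le> norm (f T) + norm (f t - f T)"
      by (metis norm_triangle_sub)
    moreover have "K * T ^ Suc m \<ge> 0"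
      using KT by simp
    moreover have "norm (f T) * 1 \<le> norm (f T) * t ^ Suc m"
      using KT that by (intro mult_left_mono one_le_power) auto
    ultimately show ?thesis by (simp only: distrib_right)
  qed
  then have "eventually (\<lambda>t. norm (norm (f t)) \<le> (norm (f T) + K) * norm (t ^ Suc m)) at_top"
    using KT(2) by (intro eventually_at_top_linorderI[of T]) simp
  then show ?thesis by (rule landau_o.bigI[rotated]) (use KT(1) in \<open>simp add: add_nonneg_pos\<close>)
qed

text \<open>Comparison with the primitive \<open>- K / t ^ (m + 1)\<close> bounds all increments
  beyond \<open>r\<close> uniformly. This gives the Cauchy property, and letting the far endpoint
  tend to infinity turns the same bound into the rate of convergence.\<close>

lemma limit_from_derivative_decay:
  fixes f :: "real \<Rightarrow> 'a::banach"
  assumes "\<And>t. (f has_vector_derivative f' t) (at t)"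
    and "(\<lambda>t. norm (f' t)) \<in> O(\<lambda>t. 1 / t ^ (m + 2))"
  obtains L where "(f \<longlongrightarrow> L) at_top" "(\<lambda>t. norm (f t - L)) \<in> O(\<lambda>t. 1 / t ^ (m + 1))"
proof -
  obtain K T where KT: "K > 0" "T \<ge> 1"
      "\<And>t. t \<ge> T \<Longrightarrow> norm (norm (f' t)) \<le> K * norm (1 / t ^ (m + 2))"
    using eventually_at_top_bound[OF assms(2)] by blast
  have tail: "norm (f s - f r) \<le> K / r ^ (m + 1)" if "T \<le> r" "r \<le> s" for r s
  proof -
    have "norm (f s - f r) \<le> - K / s ^ (m + 1) - (- K / r ^ (m + 1))"
    proof (rule norm_diff_le_primitive[OF that(2)])
      fix t assume "r \<le> t"
      with that KT have t: "t \<ge> T" "t > 0" by auto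
      show "((\<lambda>t. - K / t ^ (m + 1)) has_real_derivative K * (real (m + 1) / t ^ (m + 2))) (at t)"
      proof -
        have "((\<lambda>t. t ^ (m + 1)) has_real_derivative real (m + 1) * t ^ m) (at t)"
          using DERIV_pow[of "m + 1" t] by simp
        then have "((\<lambda>t. - K * inverse (t ^ (m + 1))) has_real_derivative
            K * (real (m + 1) / t ^ (m + 2))) (at t)"
          by (rule DERIV_cong[OF DERIV_cmult[OF DERIV_inverse_fun]]) (use t in \<open>simp_all add: field_simps\<close>)
        then show ?thesis unfolding divide_inverse[of "- K"] .
      qed
      have "norm (f' t) \<le> K * (1 / t ^ (m + 2))"
        using KT(3)[OF t(1)] t by simp
      also have "\<dots> \<le> K * (real (m + 1) / t ^ (m + 2))"
        using KT t by (intro mult_left_mono divide_right_mono) auto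
      finally show "norm (f' t) \<le> K * (real (m + 1) / t ^ (m + 2))" .
    qed (rule assms)
    moreover have "K / s ^ (m + 1) \<ge> 0" using KT that by simp
    ultimately show ?thesis by simp
  qed
  have small: "((\<lambda>r. K / r ^ (m + 1)) \<longlongrightarrow> 0) at_top"
    by real_asymp
  \<comment> \<open>The limit is first taken along the integers; \<open>tail\<close> then carries it
    over to real arguments.\<close>
  have "Cauchy (\<lambda>n. f (real n))"
  proof (rule metric_CauchyI)
    fix e :: real assume "e > 0"
    then have "eventually (\<lambda>r. K / r ^ (m + 1) < e / 2) at_top"
      using small by (intro order_tendstoD) auto
    then have "eventually (\<lambda>r. K / r ^ (m + 1) < e / 2 \<and> r \<ge> T) at_top"
      by (intro eventually_conj eventually_ge_at_top)
    then obtain R where R: "\<And>r. r \<ge> R \<Longrightarrow> K / r ^ (m + 1) < e / 2 \<and> r \<ge> T"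
      by (auto simp: eventually_at_top_linorder)
    obtain N where N: "real N \<ge> R" using real_arch_simple by blast
    have "dist (f (real n)) (f (real N)) < e / 2" if "n \<ge> N" for n
      using tail[of "real N" "real n"] R[OF N] that unfolding dist_norm
      by (smt (verit) of_nat_le_iff)
    then have "dist (f (real n)) (f (real n')) < e" if "n \<ge> N" "n' \<ge> N" for n n'
      using that dist_triangle_half_l by blast
    then show "\<exists>N. \<forall>n\<ge>N. \<forall>n'\<ge>N. dist (f (real n)) (f (real n')) < e"
      by blast
  qed
  then obtain L where L: "(\<lambda>n. f (real n)) \<longlonglongrightarrow> L"
    using Cauchy_convergent convergent_def by blast
  have bound: "norm (f r - L) \<le> K / r ^ (m + 1)" if "r \<ge> T" for r
  proof (rule tendsto_upperbound)
    show "(\<lambda>n. norm (f r - f (real n))) \<longlonglongrightarrow> norm (f r - L)"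
      by (intro tendsto_intros L)
    obtain N where N: "real N \<ge> r" using real_arch_simple by blast
    show "eventually (\<lambda>n. norm (f r - f (real n)) \<le> K / r ^ (m + 1)) sequentially"
      using tail[OF that] N
      by (intro eventually_sequentiallyI[of N]) (simp add: norm_minus_commute[of "f r"])
  qed auto
  have "(f \<longlongrightarrow> L) at_top"
    unfolding tendsto_dist_iff[of f] dist_norm
  proof (rule tendsto_sandwich[OF _ _ tendsto_const small])
    show "eventually (\<lambda>r. norm (f r - L) \<le> K / r ^ (m + 1)) at_top"
      by (rule eventually_at_top_linorderI[of T]) (rule bound)
  qed simp
  moreover have "(\<lambda>t. norm (f t - L)) \<in> O(\<lambda>t. 1 / t ^ (m + 1))"
    using bound KT(2) by (intro landau_o.bigI[OF KT(1)] eventually_at_top_linorderI[of T]) simp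
  ultimately show ?thesis by (rule that)
qed

text \<open>Integration from 0 gives one primitive for the whole line. The auxiliary interval
  depends on \<open>x\<close> only so that both 0 and \<open>x\<close> lie in its interior.\<close>

lemma continuous_has_primitive:
  fixes f :: "real \<Rightarrow> real"
  assumes "continuous_on UNIV f"
  obtains F where "\<And>x. (F has_real_derivative f x) (at x)"
proof
  fix x
  have "((\<lambda>u. LBINT y=ereal 0..u. f y) has_vector_derivative f x)
          (at x within {- \<bar>x\<bar> - 1..\<bar>x\<bar> + 1})"
    using assms
    by (intro interval_integral_FTC2) (auto intro: continuous_on_subset)
  then show "((\<lambda>u. LBINT y=ereal 0..u. f y) has_real_derivative f x) (at x)"
    by (subst (asm) at_within_interior)
       (auto simp: has_real_derivative_iff_has_vector_derivative)
qed

section \<open>The equation in a complex coordinate\<close>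

locale reduced_lie_quadratic =
  fixes z z1 z2 :: "real \<Rightarrow> complex" and \<kappa> :: real
  assumes z: "(z has_vector_derivative z1 t) (at t)"
    and z1: "(z1 has_vector_derivative z2 t) (at t)"
    and z2: "(z2 has_vector_derivative
               - (\<i> * of_real (2 * Im (cnj (z t) * z1 t) + \<kappa>) * z t)) (at t)"
    and nonzero: "z t \<noteq> 0"
    and c1_pos: "Re (z2 t * cnj (z t)) - (norm (z1 t))\<^sup>2 / 2 > 0"
begin

text \<open>The angular momentum of the planar curve \<open>z\<close>. This and the following
  quantities are written as polynomials in real components, so that derivatives can be computed
  termwise.\<close>

definition \<omega> :: "real \<Rightarrow> real" where
  "\<omega> t = Re (z t) * Im (z1 t) - Im (z t) * Re (z1 t)"

definition u :: "real \<Rightarrow> real" where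
  "u t = (Re (z t))\<^sup>2 + (Im (z t))\<^sup>2"

definition u1 :: "real \<Rightarrow> real" where
  "u1 t = 2 * (Re (z t) * Re (z1 t) + Im (z t) * Im (z1 t))"

text \<open>The derivative of \<open>k = 2 * \<omega> + \<kappa>\<close>.\<close>

definition k1 :: "real \<Rightarrow> real" where
  "k1 t = 2 * (Re (z t) * Im (z2 t) - Im (z t) * Re (z2 t))"

text \<open>The angular momentum of the curve \<open>z1\<close>; it enters k'' beside the restoring
  term - 2 k u.\<close>

definition g :: "real \<Rightarrow> real" where
  "g t = Re (z1 t) * Im (z2 t) - Im (z1 t) * Re (z2 t)"

lemmas component_derivatives =
  z[THEN has_field_derivative_Re] z[THEN has_field_derivative_Im]
  z1[THEN has_field_derivative_Re] z1[THEN has_field_derivative_Im]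
  z2[THEN has_field_derivative_Re] z2[THEN has_field_derivative_Im]

lemma u_eq: "u t = (norm (z t))\<^sup>2"
  by (simp add: u_def cmod_power2)

lemma u_pos: "u t > 0"
  using nonzero by (simp add: u_eq)

lemma u_deriv: "(u has_real_derivative u1 t) (at t)"
  unfolding u_def[abs_def] u1_def
  by (rule component_derivatives DERIV_cdivide refl derivative_eq_intros)+ (simp add: algebra_simps)

lemma \<omega>_deriv: "(\<omega> has_real_derivative k1 t / 2) (at t)"
  unfolding \<omega>_def[abs_def] k1_def
  by (rule component_derivatives DERIV_cdivide refl derivative_eq_intros)+ (simp add: algebra_simps)

lemma k1_deriv: "(k1 has_real_derivative 2 * g t - 2 * (2 * \<omega> t + \<kappa>) * u t) (at t)"
  unfolding k1_def[abs_def] g_def u_def \<omega>_def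
  by (rule component_derivatives DERIV_cdivide refl derivative_eq_intros)+
     (simp add: algebra_simps power2_eq_square)

section \<open>Conserved energy and upper growth bounds\<close>

text \<open>The derivative of |z''|^2 is - k k', since z''' = - i k z and k' = 2 Im (cnj z * z'');
  the derivative of k^2 / 2 cancels it.\<close>

lemma energy_constant:
  obtains M where "\<And>t. (norm (z2 t))\<^sup>2 + (2 * \<omega> t + \<kappa>)\<^sup>2 / 2 = M"
proof -
  have "((\<lambda>t. (Re (z2 t))\<^sup>2 + (Im (z2 t))\<^sup>2 + (2 * \<omega> t + \<kappa>)\<^sup>2 / 2) has_real_derivative 0) (at t)" for t
    by (rule component_derivatives \<omega>_deriv DERIV_cdivide refl derivative_eq_intros)+
       (simp add: k1_def \<omega>_def algebra_simps power2_eq_square add_divide_distrib diff_divide_distrib)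
  note const = DERIV_isconst_all[OF allI, OF this]
  show ?thesis
    by (rule that, unfold cmod_power2) (rule const[of _ 0])
qed

text \<open>Boundedness is expressed through \<open>t ^ 0\<close> to fit the case m = 0 of
  \<open>growth_from_derivative\<close>.\<close>

lemma z2_bounded: "(\<lambda>t. norm (z2 t)) \<in> O(\<lambda>t. t ^ 0)"
proof -
  obtain M where M: "\<And>t. (norm (z2 t))\<^sup>2 + (2 * \<omega> t + \<kappa>)\<^sup>2 / 2 = M"
    using energy_constant by blast
  have "norm (z2 t) \<le> sqrt M" for t
    using M[of t] zero_le_power2[of "2 * \<omega> t + \<kappa>"] by (intro real_le_rsqrt) linarith
  then show ?thesis
    by (intro bigoI[of _ "sqrt M"]) simp
qed

lemma \<omega>_bounded: "\<omega> \<in> O(\<lambda>_. 1)"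
proof -
  obtain M where M: "\<And>t. (norm (z2 t))\<^sup>2 + (2 * \<omega> t + \<kappa>)\<^sup>2 / 2 = M"
    using energy_constant by blast
  have "\<bar>2 * \<omega> t + \<kappa>\<bar> \<le> sqrt (2 * M)" for t
  proof (rule real_le_rsqrt)
    show "\<bar>2 * \<omega> t + \<kappa>\<bar>\<^sup>2 \<le> 2 * M"
      using M[of t] zero_le_power2[of "norm (z2 t)"] unfolding power2_abs by linarith
  qed
  note bound = this
  have "\<bar>\<omega> t\<bar> \<le> sqrt (2 * M) + \<bar>\<kappa>\<bar>" for t
    using bound[of t] by linarith
  then show ?thesis
    by (intro bigoI[of _ "sqrt (2 * M) + \<bar>\<kappa>\<bar>"]) simp
qed

lemma z1_growth: "(\<lambda>t. norm (z1 t)) \<in> O(\<lambda>t. t)"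
  using growth_from_derivative[OF z1 z2_bounded] by simp

lemma z_growth: "(\<lambda>t. norm (z t)) \<in> O(\<lambda>t. t\<^sup>2)"
  using growth_from_derivative[OF z, of 1] z1_growth by (simp add: numeral_2_eq_2)

section \<open>Conservation of c1 and the lower growth bound\<close>

text \<open>The constant \<open>c\<close> is c1 itself. It is conserved because z''' is
  perpendicular to z, and it eliminates z'' from u'' = 2 |z'|^2 + 2 Re (z'' * cnj z).\<close>

lemma u1_deriv:
  obtains c where "c > 0"
    "\<And>t. (u1 has_real_derivative 2 * c + 3 * (norm (z1 t))\<^sup>2) (at t)"
proof -
  define F where "F t = Re (z t) * Re (z2 t) + Im (z t) * Im (z2 t)
                 - ((Re (z1 t))\<^sup>2 + (Im (z1 t))\<^sup>2) / 2" for t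
  have "(F has_real_derivative 0) (at t)" for t
    unfolding F_def[abs_def]
    by (rule component_derivatives DERIV_cdivide refl derivative_eq_intros)+
       (simp add: algebra_simps power2_eq_square)
  then have const: "F t = F 0" for t
    by (intro DERIV_isconst_all allI)
  have "F 0 > 0"
    using c1_pos[of 0] by (simp add: F_def cmod_power2 algebra_simps)
  then show ?thesis
  proof (rule that[of "F 0"])
    fix t
    show "(u1 has_real_derivative 2 * F 0 + 3 * (norm (z1 t))\<^sup>2) (at t)"
      unfolding u1_def[abs_def] const[of t, symmetric]
      by (rule component_derivatives DERIV_cdivide refl derivative_eq_intros)+
         (simp add: F_def cmod_power2[unfolded power2_eq_square] power2_eq_square algebra_simps
            add_divide_distrib)
  qed
qed

lemma u1_eventually_pos: obtains T where "u1 T > 0"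
proof -
  obtain c where c: "c > 0"
    "\<And>t. (u1 has_real_derivative 2 * c + 3 * (norm (z1 t))\<^sup>2) (at t)"
    using u1_deriv by blast
  have "u1 0 - 2 * c * 0 \<le> u1 t - 2 * c * t" if "t \<ge> 0" for t
  proof (rule DERIV_nonneg_imp_nondecreasing[OF that], intro exI conjI)
    fix s
    show "((\<lambda>t. u1 t - 2 * c * t) has_real_derivative 3 * (norm (z1 s))\<^sup>2) (at s)"
      by (auto intro!: derivative_eq_intros c)
  qed simp
  \<comment> \<open>As \<open>u1\<close> has slope at least \<open>2 * c\<close>, it has risen by at
    least \<open>\<bar>u1 0\<bar> + 1\<close> at this time, so it is positive there.\<close>
  note this[of "(\<bar>u1 0\<bar> + 1) / (2 * c)"]
  moreover have "2 * c * ((\<bar>u1 0\<bar> + 1) / (2 * c)) = \<bar>u1 0\<bar> + 1"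
    using c(1) by simp
  moreover have "(\<bar>u1 0\<bar> + 1) / (2 * c) \<ge> 0"
    using c(1) by simp
  ultimately have "u1 ((\<bar>u1 0\<bar> + 1) / (2 * c)) > 0" by simp
  then show ?thesis by (rule that)
qed

text \<open>Since \<open>c1 > 0\<close>, the function \<open>u powr (1/4)\<close> is convex; once it increases it grows at least
  linearly.\<close>

lemma inverse_u_decay: "(\<lambda>t. 1 / u t) \<in> O(\<lambda>t. 1 / t ^ 4)"
proof -
  obtain c where c: "c > 0"
    "\<And>t. (u1 has_real_derivative 2 * c + 3 * (norm (z1 t))\<^sup>2) (at t)"
    using u1_deriv by blast
  obtain T where T: "u1 T > 0" by (rule u1_eventually_pos)
  \<comment> \<open>The exponent 1/4 is the smallest for which the estimate \<open>speed\<close>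
    absorbs the negative term of the second derivative. Linear growth of \<open>p\<close> then means
    quartic growth of \<open>u\<close>.\<close>
  define p where "p t = u t powr (1/4)" for t
  define p1 where "p1 t = u1 t * u t powr (-3/4) / 4" for t
  have p_deriv: "(p has_real_derivative p1 t) (at t)" for t
    unfolding p_def[abs_def] p1_def
    by (rule u_deriv c(2) refl derivative_eq_intros | use u_pos in simp)+
  have mono: "p1 s \<le> p1 t" if "s \<le> t" for s t
  proof (rule DERIV_nonneg_imp_nondecreasing[OF that], intro exI conjI)
    fix s
    show "(p1 has_real_derivative
        ((2 * c + 3 * (norm (z1 s))\<^sup>2) * u s powr (-3/4)
          - u1 s * ((3/4) * u s powr (-7/4) * u1 s)) / 4) (at s)"
      unfolding p1_def[abs_def]
      by (rule u_deriv c(2) refl derivative_eq_intros | use u_pos in simp)+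
    have eq: "u s powr (-3/4) = u s * u s powr (-7/4)"
      using u_pos[of s] by (simp add: powr_mult_base)
    \<comment> \<open>Lagrange's identity: the defect in this Cauchy-Schwarz inequality is the
      squared angular momentum, up to the factor 4.\<close>
    have speed: "(u1 s)\<^sup>2 \<le> 4 * u s * (norm (z1 s))\<^sup>2"
    proof -
      have "4 * u s * (norm (z1 s))\<^sup>2 - (u1 s)\<^sup>2 = 4 * (\<omega> s)\<^sup>2"
        unfolding cmod_power2
        by (simp add: u_def u1_def \<omega>_def power2_eq_square algebra_simps)
      then show ?thesis by (smt (verit) zero_le_power2)
    qed
    have "c * u s > 0" using c u_pos by simp
    show "0 \<le> ((2 * c + 3 * (norm (z1 s))\<^sup>2) * u s powr (-3/4)
          - u1 s * ((3/4) * u s powr (-7/4) * u1 s)) / 4"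
    proof -
      have "0 \<le> u s powr (-7/4) * (2 * (c * u s) + 3 * (u s * (norm (z1 s))\<^sup>2) - 3/4 * (u1 s)\<^sup>2)"
        using speed \<open>c * u s > 0\<close> by (intro mult_nonneg_nonneg) auto
      also have "\<dots> = (2 * c + 3 * (norm (z1 s))\<^sup>2) * u s powr (-3/4)
          - u1 s * ((3/4) * u s powr (-7/4) * u1 s)"
        unfolding eq by (simp add: algebra_simps power2_eq_square)
      finally show ?thesis by simp
    qed
  qed
  define d where "d = p1 T"
  have "d > 0" using T u_pos[of T] by (simp add: d_def p1_def)
  have lower: "d * (t - T) \<le> p t" if "t \<ge> T" for t
  proof -
    have "p T - d * T \<le> p t - d * t"
    proof (rule DERIV_nonneg_imp_nondecreasing[OF that], intro exI conjI)
      fix s assume "T \<le> s"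
      show "((\<lambda>t. p t - d * t) has_real_derivative p1 s - d) (at s)"
        by (rule p_deriv refl derivative_eq_intros)+ simp
      show "0 \<le> p1 s - d" using mono[OF \<open>T \<le> s\<close>] by (simp add: d_def)
    qed
    moreover have "p T \<ge> 0" by (simp add: p_def)
    ultimately show ?thesis by (simp add: algebra_simps)
  qed
  have u_p: "u t = p t ^ 4" for t
    using u_pos[of t] by (simp add: p_def powr_power)
  have "eventually (\<lambda>t. norm (1 / u t) \<le> (2 / d) ^ 4 * norm (1 / t ^ 4)) at_top"
  \<comment> \<open>Beyond \<open>2 * \<bar>T\<bar>\<close> one has t - T at least t / 2, whence the
    constant \<open>(2 / d) ^ 4\<close>.\<close>
  proof (rule eventually_at_top_linorderI[of "max 1 (2 * \<bar>T\<bar>)"])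
    fix t assume t: "t \<ge> max 1 (2 * \<bar>T\<bar>)"
    have "d * (t / 2) \<le> d * (t - T)"
      using t \<open>d > 0\<close> by (intro mult_left_mono) auto
    also have "\<dots> \<le> p t" using t by (intro lower) auto
    finally have "(d * (t / 2)) ^ 4 \<le> u t"
      unfolding u_p using t \<open>d > 0\<close> by (intro power_mono) auto
    then have "1 / u t \<le> 1 / (d * (t / 2)) ^ 4"
      using t \<open>d > 0\<close> by (intro divide_left_mono mult_pos_pos) (auto simp: u_pos)
    then show "norm (1 / u t) \<le> (2 / d) ^ 4 * norm (1 / t ^ 4)"
      using u_pos[of t] t by (simp add: power_mult_distrib power_divide less_imp_le field_simps)
  qed
  then show ?thesis by (rule bigoI)
qed

section \<open>Upper bounds entering the integration by parts\<close>

lemma k1_growth: "k1 \<in> O(\<lambda>t. t\<^sup>2)"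
proof -
  have "norm (k1 t) \<le> 2 * norm (norm (z t) * norm (z2 t))" for t
  proof -
    have "k1 t = 2 * Im (cnj (z t) * z2 t)" by (simp add: k1_def)
    then show ?thesis
      using abs_Im_le_cmod[of "cnj (z t) * z2 t"] by (simp add: norm_mult)
  qed
  then have "k1 \<in> O(\<lambda>t. norm (z t) * norm (z2 t))"
    by (intro bigoI[of _ 2] always_eventually) auto
  also have "(\<lambda>t. norm (z t) * norm (z2 t)) \<in> O(\<lambda>t. t\<^sup>2 * t ^ 0)"
    by (intro landau_o.big_mult z_growth z2_bounded)
  finally show ?thesis by simp
qed

lemma g_growth: "g \<in> O(\<lambda>t. t)"
proof -
  have "norm (g t) \<le> 1 * norm (norm (z1 t) * norm (z2 t))" for t
  proof -
    have "g t = Im (cnj (z1 t) * z2 t)" by (simp add: g_def)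
    then show ?thesis
      using abs_Im_le_cmod[of "cnj (z1 t) * z2 t"] by (simp add: norm_mult)
  qed
  then have "g \<in> O(\<lambda>t. norm (z1 t) * norm (z2 t))"
    by (intro bigoI[of _ 1] always_eventually) auto
  also have "(\<lambda>t. norm (z1 t) * norm (z2 t)) \<in> O(\<lambda>t. t * t ^ 0)"
    by (intro landau_o.big_mult z1_growth z2_bounded)
  finally show ?thesis by simp
qed

lemma u1_growth: "u1 \<in> O(\<lambda>t. t ^ 3)"
proof -
  have "norm (u1 t) \<le> 2 * norm (norm (z t) * norm (z1 t))" for t
  proof -
    have "u1 t = 2 * Re (cnj (z t) * z1 t)" by (simp add: u1_def)
    then show ?thesis
      using abs_Re_le_cmod[of "cnj (z t) * z1 t"] by (simp add: norm_mult)
  qed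
  then have "u1 \<in> O(\<lambda>t. norm (z t) * norm (z1 t))"
    by (intro bigoI[of _ 2] always_eventually) auto
  also have "(\<lambda>t. norm (z t) * norm (z1 t)) \<in> O(\<lambda>t. t\<^sup>2 * t)"
    by (intro landau_o.big_mult z_growth z1_growth)
  finally show ?thesis by (simp add: power2_eq_square power3_eq_cube)
qed


section \<open>The direction of the curve and its asymptotics\<close>

text \<open>Normalizing removes the radial part of z', so only the rotation with angular velocity
  \<open>\<omega> / u\<close> remains.\<close>

lemma unit_deriv:
  "((\<lambda>t. z t /\<^sub>R norm (z t)) has_vector_derivative
     (\<omega> t / u t) *\<^sub>R (\<i> * (z t /\<^sub>R norm (z t)))) (at t)"
proof -
  define s where "s = inverse (sqrt (u t))"
  have norm_eq: "norm (z r) = sqrt (u r)" for r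
    by (simp add: u_eq)
  have "((\<lambda>t. inverse (sqrt (u t))) has_real_derivative
      - (u1 t / (2 * u t)) * s) (at t)"
  proof (rule DERIV_cong[OF DERIV_inverse_fun[OF DERIV_chain2[OF DERIV_real_sqrt[OF u_pos] u_deriv]]])
    have "- (inverse S / 2 * m * inverse (S ^ Suc (Suc 0))) = - (m / (2 * (S * S))) * inverse S"
      for S m :: real
      by (simp add: field_simps)
    from this[of "sqrt (u t)" "u1 t"]
    show "- (inverse (sqrt (u t)) / 2 * u1 t * inverse (sqrt (u t) ^ Suc (Suc 0)))
        = - (u1 t / (2 * u t)) * s"
      unfolding s_def real_sqrt_mult_self abs_of_pos[OF u_pos] .
  qed (use u_pos[of t] in simp)
  then have "((\<lambda>t. z t /\<^sub>R norm (z t)) has_vector_derivative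
      s *\<^sub>R z1 t + (- (u1 t / (2 * u t)) * s) *\<^sub>R z t) (at t)"
    unfolding norm_eq s_def by (rule has_vector_derivative_scaleR[OF _ z])
  moreover have "s *\<^sub>R z1 t + (- (u1 t / (2 * u t)) * s) *\<^sub>R z t
      = (\<omega> t / u t) *\<^sub>R (\<i> * (s *\<^sub>R z t))"
  proof -
    \<comment> \<open>These are the components of u z' = (u1 / 2 + i \<omega>) z, which holds
      because cnj z * z' = u1 / 2 + i \<omega>.\<close>
    have "u t * Re (z1 t) - u1 t / 2 * Re (z t) = - \<omega> t * Im (z t)"
      "u t * Im (z1 t) - u1 t / 2 * Im (z t) = \<omega> t * Re (z t)"
      by (simp_all add: u_def u1_def \<omega>_def algebra_simps power2_eq_square)
    note components = this
    have divide_out: "s * x + - (m / (2 * U)) * s * y = w / U * (s * c)"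
      if "U * x - m / 2 * y = w * c" "U \<noteq> 0" for x y m w c U :: real
    proof -
      have "s * x + - (m / (2 * U)) * s * y = s / U * (U * x - m / 2 * y)"
        using that(2) by (simp add: field_simps)
      also have "\<dots> = s / U * (w * c)" by (simp only: that(1))
      finally show ?thesis by simp
    qed
    have "u t \<noteq> 0" using u_pos[of t] by simp
    show ?thesis (is "?l = ?r")
    proof (rule complex_eqI)
      show "Re ?l = Re ?r"
        using divide_out[OF components(1) \<open>u t \<noteq> 0\<close>]
        by (simp only: plus_complex.sel scaleR_complex.sel times_complex.sel imaginary_unit.sel) simp
      show "Im ?l = Im ?r"
        using divide_out[OF components(2) \<open>u t \<noteq> 0\<close>]
        by (simp only: plus_complex.sel scaleR_complex.sel times_complex.sel imaginary_unit.sel) simp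
    qed
  qed
  ultimately show ?thesis
    by (simp only: norm_eq s_def)
qed

text \<open>\<open>\<Phi>\<close> is the tail integral of 1 / (2 u), characterized by its derivative
  and its limit; it is identified with an actual integral only later. To leading order \<omega> is -
  \<kappa> / 2, so the direction turns by the angle \<kappa> \<Phi> away from its limit.\<close>

lemma asymptotics:
  obtains A \<Phi> where
    "((\<lambda>t. z t /\<^sub>R norm (z t)) \<longlongrightarrow> A) at_top"
    "\<And>t. (\<Phi> has_real_derivative - (1 / (2 * u t))) (at t)" "(\<Phi> \<longlongrightarrow> 0) at_top"
    "(\<lambda>t. norm (z t - norm (z t) *\<^sub>R (A + (\<kappa> * \<Phi> t) *\<^sub>R (\<i> * A)))) \<in> O(\<lambda>t. 1 / t ^ 4)"
proof -
  define v where "v t = z t /\<^sub>R norm (z t)" for t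
  have norm_v: "norm (v t) = 1" for t
    using nonzero by (simp add: v_def)
  have v_deriv: "(v has_vector_derivative (\<omega> t / u t) *\<^sub>R (\<i> * v t)) (at t)" for t
    using unit_deriv[of t] by (simp add: v_def[abs_def])
  have \<omega>_u: "(\<lambda>t. \<omega> t / u t) \<in> O(\<lambda>t. 1 / t ^ 4)"
    using landau_o.big_mult[OF \<omega>_bounded inverse_u_decay] by simp
  then have "(\<lambda>t. norm ((\<omega> t / u t) *\<^sub>R (\<i> * v t))) \<in> O(\<lambda>t. 1 / t ^ (2 + 2))"
    by (simp add: norm_mult norm_v abs_divide[symmetric] del: abs_divide)
  from limit_from_derivative_decay[OF v_deriv this] obtain A where A: "(v \<longlongrightarrow> A) at_top"
    by blast

  have "continuous_on UNIV u"
    using u_deriv by (meson DERIV_continuous_on has_field_derivative_at_within)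
  then have "continuous_on UNIV (\<lambda>t. 1 / (2 * u t))"
    by (intro continuous_intros) (use u_pos in \<open>auto simp: less_imp_neq[symmetric]\<close>)
  then obtain P where P: "\<And>t. (P has_real_derivative 1 / (2 * u t)) (at t)"
    using continuous_has_primitive by blast
  have "(\<lambda>t. norm (1 / (2 * u t))) \<in> O(\<lambda>t. 1 / t ^ (2 + 2))"
    using landau_o.big_mult[OF bigoI[of "\<lambda>_. 1/2 :: real" "1/2" "\<lambda>_. 1"] inverse_u_decay]
    by (simp del: abs_divide)
  from limit_from_derivative_decay[OF P[unfolded has_real_derivative_iff_has_vector_derivative] this]
  obtain L where L: "(P \<longlongrightarrow> L) at_top" "(\<lambda>t. norm (P t - L)) \<in> O(\<lambda>t. 1 / t ^ (2 + 1))"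
    by blast
  define \<Phi> where "\<Phi> t = L - P t" for t
  have \<Phi>_deriv: "(\<Phi> has_real_derivative - (1 / (2 * u t))) (at t)" for t
    unfolding \<Phi>_def[abs_def] by (rule derivative_eq_intros P refl)+ simp
  have \<Phi>_lim: "(\<Phi> \<longlongrightarrow> 0) at_top"
    using tendsto_diff[OF tendsto_const[of L] L(1)] by (simp add: \<Phi>_def[abs_def])

  define a where "a t = \<kappa> * \<Phi> t" for t
  have "(\<lambda>t. norm (\<Phi> t)) \<in> O(\<lambda>t. 1 / t ^ 3)"
    using L(2) by (simp add: \<Phi>_def norm_minus_commute[of L] del: real_norm_def)
  then have "\<Phi> \<in> O(\<lambda>t. 1 / t ^ 3)"
    by simp
  then have a_decay: "a \<in> O(\<lambda>t. 1 / t ^ 3)"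
    unfolding a_def[abs_def] by (cases "\<kappa> = 0") simp_all
  have a_deriv: "(a has_real_derivative - (\<kappa> / (2 * u t))) (at t)" for t
    unfolding a_def[abs_def] by (rule DERIV_cong[OF DERIV_cmult[OF \<Phi>_deriv]]) simp
  \<comment> \<open>The factor 4 is chosen so that k'' / (4 u^2) contains - k / (2 u), which cancels
    the contribution of k to \<omega> / u = - \<kappa> / (2 u) + k / (2 u).\<close>
  define h where "h t = k1 t / (4 * (u t)\<^sup>2)" for t
  have h_decay: "h \<in> O(\<lambda>t. 1 / t ^ 6)"
  proof -
    have "(\<lambda>t. 1/4 * (k1 t * (1 / u t * (1 / u t)))) \<in> O(\<lambda>t. t\<^sup>2 * (1 / t ^ 4 * (1 / t ^ 4)))"
      by (subst landau_o.big.cmult_in_iff, simp)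
         (intro landau_o.big_mult k1_growth inverse_u_decay)
    also have "(\<lambda>t. 1/4 * (k1 t * (1 / u t * (1 / u t)))) = h"
      by (simp add: fun_eq_iff h_def power2_eq_square)
    also have "(\<lambda>t. t\<^sup>2 * (1 / t ^ 4 * (1 / t ^ 4))) \<in> O(\<lambda>t::real. 1 / t ^ 6)"
      by real_asymp
    finally show ?thesis .
  qed
  have h_deriv: "(h has_real_derivative
      g t / (2 * (u t)\<^sup>2) - (2 * \<omega> t + \<kappa>) / (2 * u t) - k1 t * u1 t / (2 * (u t) ^ 3)) (at t)" for t
  proof -
    have "((\<lambda>t. 4 * (u t)\<^sup>2) has_real_derivative 8 * (u t * u1 t)) (at t)"
      by (rule u_deriv refl derivative_eq_intros)+ simp
    from DERIV_divide[OF k1_deriv this] u_pos[of t]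
    have "(h has_real_derivative ((2 * g t - 2 * (2 * \<omega> t + \<kappa>) * u t) * (4 * (u t)\<^sup>2)
        - k1 t * (8 * (u t * u1 t))) / (4 * (u t)\<^sup>2 * (4 * (u t)\<^sup>2))) (at t)"
      by (simp add: h_def[abs_def])
    moreover have "((2 * x - 2 * y * U) * (4 * U\<^sup>2) - z * (8 * (U * w))) / (4 * U\<^sup>2 * (4 * U\<^sup>2))
        = x / (2 * U\<^sup>2) - y / (2 * U) - z * w / (2 * U ^ 3)" if "U \<noteq> 0" for x y z w U :: real
      using that by (simp add: field_simps power2_eq_square power3_eq_cube)
    ultimately show ?thesis using u_pos[of t] by (metis less_irrefl)
  qed

  \<comment> \<open>\<open>a\<close> removes the expected drift of the direction, and \<open>h\<close> is the boundary term of the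
    integration by parts.\<close>
  define W where "W t = v t + (h t - a t) *\<^sub>R (\<i> * v t)" for t
  \<comment> \<open>\<open>R\<close> is what survives of the angular velocity after both
    corrections. \<open>S\<close> is a second-order effect: the vector i v inside the correction
    term rotates as well.\<close>
  define R where "R t = g t / (2 * (u t)\<^sup>2) - k1 t * u1 t / (2 * (u t) ^ 3)" for t
  define S where "S t = (h t - a t) * (\<omega> t / u t)" for t
  have W_deriv: "(W has_vector_derivative R t *\<^sub>R (\<i> * v t) - S t *\<^sub>R v t) (at t)" for t
  proof -
    define d where "d = g t / (2 * (u t)\<^sup>2) - (2 * \<omega> t + \<kappa>) / (2 * u t)
      - k1 t * u1 t / (2 * (u t) ^ 3) - - (\<kappa> / (2 * u t))"
    have "((\<lambda>t. \<i> * v t) has_vector_derivative \<i> * ((\<omega> t / u t) *\<^sub>R (\<i> * v t))) (at t)"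
      by (rule has_vector_derivative_mult_right[OF v_deriv])
    then have W': "(W has_vector_derivative (\<omega> t / u t) *\<^sub>R (\<i> * v t)
        + ((h t - a t) *\<^sub>R (\<i> * ((\<omega> t / u t) *\<^sub>R (\<i> * v t))) + d *\<^sub>R (\<i> * v t))) (at t)"
      unfolding W_def[abs_def] d_def
      by (intro has_vector_derivative_add v_deriv has_vector_derivative_scaleR DERIV_diff
            h_deriv a_deriv)
    have "\<omega> t / u t + d = R t"
      by (simp add: d_def R_def add_divide_distrib)
    then have R_split: "R t *\<^sub>R (\<i> * v t) = (\<omega> t / u t) *\<^sub>R (\<i> * v t) + d *\<^sub>R (\<i> * v t)"
      by (simp add: scaleR_left_distrib[symmetric])
    have "(h t - a t) *\<^sub>R (\<i> * ((\<omega> t / u t) *\<^sub>R (\<i> * v t))) = - (S t *\<^sub>R v t)"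
      by (simp add: S_def mult.assoc[symmetric])
    with W' have "(W has_vector_derivative
        (\<omega> t / u t) *\<^sub>R (\<i> * v t) + (- (S t *\<^sub>R v t) + d *\<^sub>R (\<i> * v t))) (at t)"
      by (simp only:)
    then show ?thesis
      unfolding R_split by (simp only: add_ac diff_conv_add_uminus)
  qed
  \<comment> \<open>Power counting: the first term has order 1 - 8 = -7 and the second 2 + 3 - 12 =
    -7.\<close>
  have R_decay: "R \<in> O(\<lambda>t. 1 / t ^ 7)"
  proof -
    have "(\<lambda>t. 1/2 * (g t * (1 / u t * (1 / u t)))) \<in> O(\<lambda>t. t * (1 / t ^ 4 * (1 / t ^ 4)))"
      by (subst landau_o.big.cmult_in_iff, simp)
         (intro landau_o.big_mult g_growth inverse_u_decay)
    also have "(\<lambda>t. t * (1 / t ^ 4 * (1 / t ^ 4))) \<in> O(\<lambda>t::real. 1 / t ^ 7)"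
      by real_asymp
    also have "(\<lambda>t. 1/2 * (g t * (1 / u t * (1 / u t)))) = (\<lambda>t. g t / (2 * (u t)\<^sup>2))"
      by (simp add: fun_eq_iff power2_eq_square)
    finally have 1: "(\<lambda>t. g t / (2 * (u t)\<^sup>2)) \<in> O(\<lambda>t. 1 / t ^ 7)" .
    have "(\<lambda>t. 1/2 * (k1 t * u1 t * (1 / u t * (1 / u t * (1 / u t)))))
        \<in> O(\<lambda>t. t\<^sup>2 * t ^ 3 * (1 / t ^ 4 * (1 / t ^ 4 * (1 / t ^ 4))))"
      by (subst landau_o.big.cmult_in_iff, simp)
         (intro landau_o.big_mult k1_growth u1_growth inverse_u_decay)
    also have "(\<lambda>t. t\<^sup>2 * t ^ 3 * (1 / t ^ 4 * (1 / t ^ 4 * (1 / t ^ 4)))) \<in> O(\<lambda>t::real. 1 / t ^ 7)"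
      by real_asymp
    also have "(\<lambda>t. 1/2 * (k1 t * u1 t * (1 / u t * (1 / u t * (1 / u t)))))
        = (\<lambda>t. k1 t * u1 t / (2 * (u t) ^ 3))"
      by (simp add: fun_eq_iff power3_eq_cube)
    finally have 2: "(\<lambda>t. k1 t * u1 t / (2 * (u t) ^ 3)) \<in> O(\<lambda>t. 1 / t ^ 7)" .
    show ?thesis
      unfolding R_def[abs_def] by (rule sum_in_bigo(2)[OF 1 2])
  qed
  have ha_decay: "(\<lambda>t. h t - a t) \<in> O(\<lambda>t. 1 / t ^ 3)"
  proof (rule sum_in_bigo(2)[OF _ a_decay])
    have "(\<lambda>t. 1 / t ^ 6) \<in> O(\<lambda>t::real. 1 / t ^ 3)" by real_asymp
    with h_decay show "h \<in> O(\<lambda>t. 1 / t ^ 3)" by (rule landau_o.big_trans)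
  qed
  have S_decay: "S \<in> O(\<lambda>t. 1 / t ^ 7)"
    using landau_o.big_mult[OF ha_decay \<omega>_u] by (simp add: S_def[abs_def])
  have "(\<lambda>t. norm (R t *\<^sub>R (\<i> * v t) - S t *\<^sub>R v t)) \<in> O(\<lambda>t. \<bar>R t\<bar> + \<bar>S t\<bar>)"
  proof (intro bigoI[of _ 1] always_eventually allI)
    fix t
    show "norm (norm (R t *\<^sub>R (\<i> * v t) - S t *\<^sub>R v t)) \<le> 1 * norm (\<bar>R t\<bar> + \<bar>S t\<bar>)"
      using norm_triangle_ineq4[of "R t *\<^sub>R (\<i> * v t)" "S t *\<^sub>R v t"]
      by (simp add: norm_mult norm_v)
  qed
  also have "(\<lambda>t. \<bar>R t\<bar> + \<bar>S t\<bar>) \<in> O(\<lambda>t. 1 / t ^ 7)"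
    using R_decay S_decay by (intro sum_in_bigo(1)) simp_all
  \<comment> \<open>The exponent is split as 5 + 2 to apply the decay lemma with m = 5, which makes
    \<open>W\<close> converge at rate t^-6.\<close>
  finally have "(\<lambda>t. norm (R t *\<^sub>R (\<i> * v t) - S t *\<^sub>R v t)) \<in> O(\<lambda>t. 1 / t ^ (5 + 2))"
    by simp
  from limit_from_derivative_decay[OF W_deriv this] obtain B where
    B: "(W \<longlongrightarrow> B) at_top" "(\<lambda>t. norm (W t - B)) \<in> O(\<lambda>t. 1 / t ^ (5 + 1))"
    by blast
  have "(W \<longlongrightarrow> A + 0 *\<^sub>R (\<i> * A)) at_top"
    unfolding W_def[abs_def]
  proof (intro tendsto_intros A)
    have "(\<lambda>t. 1 / t ^ 3) \<in> o(\<lambda>_::real. 1 :: real)" by real_asymp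
    with ha_decay have "(\<lambda>t. h t - a t) \<in> o(\<lambda>_. 1)" by (rule landau_o.big_small_trans)
    then show "((\<lambda>t. h t - a t) \<longlongrightarrow> 0) at_top"
      by (auto dest: smalloD_tendsto)
  qed
  \<comment> \<open>Both corrections vanish at infinity, so \<open>W\<close> and \<open>v\<close>
    have the same limit.\<close>
  then have "B = A"
    using tendsto_unique[OF _ B(1)] by simp

  \<comment> \<open>Solving W = (1 + i (h - a)) v for v: multiplication by 1 + i a inverts 1 - i a
    up to a^2, and a^2 = O(t^-6) is negligible.\<close>
  have key: "norm (v t - (A + a t *\<^sub>R (\<i> * A)))
      \<le> (1 + \<bar>a t\<bar>) * (norm (W t - B) + \<bar>h t\<bar>) + (a t)\<^sup>2" for t
  proof -
    have "v t - (A + a t *\<^sub>R (\<i> * A))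
        = (1 + \<i> * of_real (a t)) * ((W t - A) - of_real (h t) * (\<i> * v t)) - of_real ((a t)\<^sup>2) * v t"
      by (simp add: W_def scaleR_conv_of_real algebra_simps power2_eq_square)
    also have "norm \<dots> \<le> norm (1 + \<i> * of_real (a t)) * norm ((W t - A) - of_real (h t) * (\<i> * v t))
        + (a t)\<^sup>2"
      by (rule order_trans[OF norm_triangle_ineq4]) (simp add: norm_mult norm_v norm_power)
    also have "\<dots> \<le> (1 + \<bar>a t\<bar>) * (norm (W t - B) + \<bar>h t\<bar>) + (a t)\<^sup>2"
    proof (intro add_right_mono mult_mono)
      show "norm (1 + \<i> * of_real (a t)) \<le> 1 + \<bar>a t\<bar>"
        using norm_triangle_ineq[of 1 "\<i> * of_real (a t)"] by (simp add: norm_mult)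
      show "norm ((W t - A) - of_real (h t) * (\<i> * v t)) \<le> norm (W t - B) + \<bar>h t\<bar>"
        using norm_triangle_ineq4[of "W t - A" "of_real (h t) * (\<i> * v t)"]
        by (simp add: norm_mult norm_v \<open>B = A\<close>)
    qed auto
    finally show ?thesis .
  qed
  have z_eq: "z t = norm (z t) *\<^sub>R v t" for t
    using nonzero by (simp add: v_def)
  have "(\<lambda>t. norm (z t - norm (z t) *\<^sub>R (A + a t *\<^sub>R (\<i> * A))))
      \<in> O(\<lambda>t. norm (z t) * ((1 + \<bar>a t\<bar>) * (norm (W t - B) + \<bar>h t\<bar>) + (a t)\<^sup>2))"
  proof (intro bigoI[of _ 1] always_eventually allI)
    fix t
    have "norm (z t - norm (z t) *\<^sub>R (A + a t *\<^sub>R (\<i> * A)))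
        = norm (z t) * norm (v t - (A + a t *\<^sub>R (\<i> * A)))"
      by (subst z_eq) (simp add: scaleR_right_diff_distrib[symmetric] norm_v)
    also have "\<dots> \<le> norm (z t) * ((1 + \<bar>a t\<bar>) * (norm (W t - B) + \<bar>h t\<bar>) + (a t)\<^sup>2)"
      by (intro mult_left_mono key) simp
    finally show "norm (norm (z t - norm (z t) *\<^sub>R (A + a t *\<^sub>R (\<i> * A))))
        \<le> 1 * norm (norm (z t) * ((1 + \<bar>a t\<bar>) * (norm (W t - B) + \<bar>h t\<bar>) + (a t)\<^sup>2))"
      by simp
  qed
  \<comment> \<open>The direction is known up to t^-6; the factor |z| = O(t^2) costs two powers and
    leaves t^-4.\<close>
  also have "(\<lambda>t. norm (z t) * ((1 + \<bar>a t\<bar>) * (norm (W t - B) + \<bar>h t\<bar>) + (a t)\<^sup>2))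
      \<in> O(\<lambda>t. t\<^sup>2 * (1 / t ^ 6))"
  proof (intro landau_o.big_mult z_growth sum_in_bigo(1))
    have a1: "(\<lambda>t. 1 + \<bar>a t\<bar>) \<in> O(\<lambda>_. 1)"
    proof (intro sum_in_bigo(1))
      have "(\<lambda>t. 1 / t ^ 3) \<in> O(\<lambda>_::real. 1 :: real)" by real_asymp
      with a_decay have "a \<in> O(\<lambda>_. 1)" by (rule landau_o.big_trans)
      then show "(\<lambda>t. \<bar>a t\<bar>) \<in> O(\<lambda>_. 1)" by simp
    qed simp
    have "(\<lambda>t. norm (W t - B) + \<bar>h t\<bar>) \<in> O(\<lambda>t. 1 / t ^ 6)"
      using B(2) h_decay by (intro sum_in_bigo(1)) simp_all
    from landau_o.big_mult[OF a1 this]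
    show "(\<lambda>t. (1 + \<bar>a t\<bar>) * (norm (W t - B) + \<bar>h t\<bar>)) \<in> O(\<lambda>t. 1 / t ^ 6)"
      by simp
    show "(\<lambda>t. (a t)\<^sup>2) \<in> O(\<lambda>t. 1 / t ^ 6)"
      using landau_o.big_mult[OF a_decay a_decay] by (simp add: power2_eq_square)
  qed
  also have "(\<lambda>t. t\<^sup>2 * (1 / t ^ 6)) \<in> O(\<lambda>t::real. 1 / t ^ 4)"
    by real_asymp
  finally show ?thesis
    using A \<Phi>_deriv \<Phi>_lim unfolding v_def[abs_def] a_def by (intro that[of A \<Phi>])
qed

end

section \<open>Complex coordinates on \<open>delta1\<close>\<close>

definition su2_of_complex :: "complex \<Rightarrow> cmat2" where
  "su2_of_complex w = Re w *\<^sub>R su2_of_pauli pauli1 + Im w *\<^sub>R su2_of_pauli pauli2"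

text \<open>The factor undoes the i / sqrt 2 in the lower left entry. Reading off an entry gives a
  map that is linear on all matrices, so it applies to derivatives of \<open>V\<close> before they
  are known to lie in \<open>delta1\<close>.\<close>

definition complex_of_su2 :: "cmat2 \<Rightarrow> complex" where
  "complex_of_su2 X = - \<i> * of_real (sqrt 2) * X $ 2 $ 1"

lemma su2_of_complex_entries:
  "su2_of_complex w $ 1 $ 1 = 0"
  "su2_of_complex w $ 2 $ 2 = 0"
  "su2_of_complex w $ 2 $ 1 = \<i> / of_real (sqrt 2) * w"
  "su2_of_complex w $ 1 $ 2 = \<i> / of_real (sqrt 2) * cnj w"
  by (simp_all add: su2_of_complex_def su2_of_pauli_def pauli_defs complex_eq_iff)

lemma sqrt2_mult: "complex_of_real (sqrt 2) * complex_of_real (sqrt 2) = 2"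
  by (simp flip: of_real_mult)

lemma complex_of_su2_of_complex [simp]: "complex_of_su2 (su2_of_complex w) = w"
  by (simp add: complex_of_su2_def su2_of_complex_entries)

lemma su2_of_complex_of_su2:
  assumes "X \<in> delta1"
  shows "su2_of_complex (complex_of_su2 X) = X"
proof -
  obtain a b where "X = a *\<^sub>R su2_of_pauli pauli1 + b *\<^sub>R su2_of_pauli pauli2"
    using assms unfolding delta1_def span_insert span_singleton
    by (auto simp: algebra_simps eq_diff_eq)
  then have "X = su2_of_complex (Complex a b)"
    by (simp add: su2_of_complex_def)
  then show ?thesis by simp
qed

lemma su2_of_complex_in_su2: "su2_of_complex w \<in> su2"
  by (simp add: su2_def vec_eq_iff forall_2 transpose_def trace_def sum_2 su2_of_complex_entries)

lemma bounded_linear_su2_of_complex: "bounded_linear su2_of_complex"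
  unfolding su2_of_complex_def[abs_def]
  by (intro bounded_linear_add bounded_linear_scaleR_const bounded_linear_Re bounded_linear_Im)

lemma bounded_linear_complex_of_su2: "bounded_linear complex_of_su2"
  unfolding complex_of_su2_def[abs_def]
  by (intro bounded_linear_const_mult bounded_linear_compose[OF bounded_linear_vec_nth bounded_linear_vec_nth])

lemma su2_inner_su2_of_complex:
  "su2_inner (su2_of_complex a) (su2_of_complex b) = Re (a * cnj b)"
  by (simp add: su2_inner_def trace_def sum_2 matrix_matrix_mult_def su2_of_complex_entries field_simps sqrt2_mult)

lemma su2_norm_su2_of_complex: "su2_norm (su2_of_complex a) = norm a"
  by (simp add: su2_norm_def su2_inner_su2_of_complex cmod_def power2_eq_square)

text \<open>The adjoint action of \<sigma>3 is an infinitesimal rotation of \<open>delta1\<close>;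
  this is where \<kappa> = sqrt 2 * C comes from.\<close>

lemma lie_bracket_C_tilde:
  "lie_bracket (C_tilde C) (su2_of_complex a) = su2_of_complex (- (\<i> * of_real (sqrt 2 * C) * a))"
  by (simp add: lie_bracket_def C_tilde_def vec_eq_iff forall_2 sum_2 matrix_matrix_mult_def
      su2_of_complex_entries su2_of_pauli_def pauli_defs complex_eq_iff field_simps)

text \<open>Brackets within \<open>delta1\<close> point along \<sigma>3, so the double bracket of
  the equation is again a rotation of V; the two factors sqrt 2 produce the 2 in k.\<close>

lemma lie_bracket_su2_of_complex:
  "lie_bracket (su2_of_complex a) (su2_of_complex b) = C_tilde (sqrt 2 * Im (cnj b * a))"
  by (simp add: lie_bracket_def C_tilde_def vec_eq_iff forall_2 sum_2 matrix_matrix_mult_def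
      su2_of_complex_entries su2_of_pauli_def pauli_defs complex_eq_iff field_simps)

section \<open>The tail integral and the transfer to su(2)\<close>

lemma improper_integral_of_nonneg_derivative:
  fixes f F :: "real \<Rightarrow> real"
  assumes "continuous_on UNIV f"
    and "\<And>t. (F has_real_derivative - f t) (at t)"
    and "\<And>t. f t \<ge> 0"
    and "(F \<longlongrightarrow> 0) at_top"
  shows "set_integrable lborel {r..} f" "(LINT t:{r..}|lborel. f t) = F r"
proof -
  have meas: "f \<in> borel_measurable borel"
    using assms(1) by (rule borel_measurable_continuous_onI)
  have mF: "((\<lambda>t. - F t) has_real_derivative f t) (at t)" for t
    using DERIV_minus[OF assms(2)[of t]] by simp
  have nn: "(\<integral>\<^sup>+t. ennreal (f t) * indicator {r..} t \<partial>lborel) = ennreal (0 - - F r)"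
    by (rule nn_integral_FTC_atLeast[OF meas mF assms(3)])
       (use tendsto_minus[OF assms(4)] in simp)
  \<comment> \<open>\<open>F\<close> decreases to 0 and is thus nonnegative, as required to turn the
    extended value of the integral into a real one.\<close>
  have "F r \<ge> F s" if "r \<le> s" for s
    using DERIV_nonpos_imp_nonincreasing[OF that, of F] assms(2,3)
    by (metis neg_le_0_iff_le)
  then have "F r \<ge> 0"
    by (intro tendsto_upperbound[OF assms(4)] eventually_at_top_linorderI[of r]) auto
  have "has_bochner_integral lborel (\<lambda>t. indicator {r..} t *\<^sub>R f t) (F r)"
  proof (rule has_bochner_integral_nn_integral)
    show "(\<integral>\<^sup>+t. ennreal (indicator {r..} t *\<^sub>R f t) \<partial>lborel) = ennreal (F r)"
      unfolding nn[simplified, symmetric]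
      by (intro nn_integral_cong) (simp add: indicator_def)
  qed (use meas assms(3) \<open>F r \<ge> 0\<close> in auto)
  then show "set_integrable lborel {r..} f" "(LINT t:{r..}|lborel. f t) = F r"
    by (auto simp: set_integrable_def set_lebesgue_integral_def has_bochner_integral_iff)
qed

text \<open>All derivatives stay in \<open>delta1\<close>: a curve that is the image of its
  coordinate under a bounded linear map has a derivative of the same form, by uniqueness of
  derivatives.\<close>

lemma lie_quadratic_complex_coordinates:
  assumes "sub_riemannian_lie_quadratic C V"
  defines "Z \<equiv> \<lambda>n t. complex_of_su2 ((curve_deriv ^^ n) V t)"
  shows "(curve_deriv ^^ n) V t = su2_of_complex (Z n t)"
    and "(Z n has_vector_derivative Z (Suc n) t) (at t)"
proof -
  have deriv: "((curve_deriv ^^ n) V has_vector_derivative (curve_deriv ^^ Suc n) V t) (at t)" for n t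
    using assms(1)
    by (simp add: sub_riemannian_lie_quadratic_def smooth_curve_def curve_deriv_def
        vector_derivative_works)
  show Z_deriv: "(Z n has_vector_derivative Z (Suc n) t) (at t)" for n t
    unfolding Z_def by (rule bounded_linear.has_vector_derivative[OF bounded_linear_complex_of_su2 deriv])
  show "(curve_deriv ^^ n) V t = su2_of_complex (Z n t)"
  proof (induction n arbitrary: t)
    case 0
    then show ?case
      using assms(1) by (simp add: Z_def sub_riemannian_lie_quadratic_def su2_of_complex_of_su2)
  next
    case (Suc n)
    have "((curve_deriv ^^ n) V has_vector_derivative su2_of_complex (Z (Suc n) t)) (at t)"
      unfolding ext[of "(curve_deriv ^^ n) V", OF Suc]
      by (rule bounded_linear.has_vector_derivative[OF bounded_linear_su2_of_complex Z_deriv])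
    from vector_derivative_unique_at[OF deriv this] show ?case .
  qed
qed

theorem mainTheorem7:
  fixes C :: real and V :: "real \<Rightarrow> cmat2" and q :: "real \<Rightarrow> real"
  assumes "sub_riemannian_lie_quadratic C V"
    and "\<And>t. V t \<noteq> 0"
    and "\<And>t. lq_c1 V t > 0"
    and q: "\<And>t. q t = su2_norm (V t)"
  shows "((\<lambda>t. V t /\<^sub>R su2_norm (V t)) \<longlongrightarrow> alpha_plus V) at_top
    \<and> (\<forall>r. set_integrable lborel {r..} (\<lambda>t. 1 / (2 * (q t)\<^sup>2)))
    \<and> (\<exists>E. su2_bigo E (\<lambda>r. r powi (- 4)) \<and>
        (\<forall>r. V r = q r *\<^sub>R alpha_plus V
                   - (q r * (LINT t:{r..}|lborel. 1 / (2 * (q t)\<^sup>2)))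
                       *\<^sub>R lie_bracket (C_tilde C) (alpha_plus V)
                   + E r))"
proof -
  define Z where "Z n t = complex_of_su2 ((curve_deriv ^^ n) V t)" for n t
  note coords = lie_quadratic_complex_coordinates[OF assms(1), folded Z_def]
  have V: "V t = su2_of_complex (Z 0 t)" for t
    using coords(1)[of 0 t] by simp
  have V1: "curve_deriv V t = su2_of_complex (Z 1 t)" for t
    using coords(1)[of 1 t] by simp
  have sqrt2: "sqrt 2 * (sqrt 2 * x) = 2 * x" for x
    by (simp flip: mult.assoc)
  have Z3: "Z 3 t = - (\<i> * of_real (2 * Im (cnj (Z 0 t) * Z 1 t) + sqrt 2 * C) * Z 0 t)" for t
  proof -
    have "su2_of_complex (Z 3 t) = (curve_deriv ^^ 3) V t"
      by (simp only: coords(1))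
    also have "\<dots> = lie_bracket (lie_bracket (curve_deriv V t) (V t)) (V t)
            + lie_bracket (C_tilde C) (V t)"
      using assms(1) by (simp only: sub_riemannian_lie_quadratic_def)
    also have "\<dots> = su2_of_complex (- (\<i> * of_real (2 * Im (cnj (Z 0 t) * Z 1 t)) * Z 0 t)
        + - (\<i> * of_real (sqrt 2 * C) * Z 0 t))"
      unfolding V V1 lie_bracket_su2_of_complex lie_bracket_C_tilde
        linear_add[OF bounded_linear.linear[OF bounded_linear_su2_of_complex]] sqrt2 ..
    finally have "complex_of_su2 (su2_of_complex (Z 3 t)) = - (\<i> * of_real (2 * Im (cnj (Z 0 t) * Z 1 t)) * Z 0 t)
        + - (\<i> * of_real (sqrt 2 * C) * Z 0 t)"
      by (simp only: complex_of_su2_of_complex)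
    then show ?thesis by (simp add: algebra_simps)
  qed
  interpret reduced_lie_quadratic "Z 0" "Z 1" "Z 2" "sqrt 2 * C"
  proof
    fix t
    show "(Z 0 has_vector_derivative Z 1 t) (at t)" "(Z 1 has_vector_derivative Z 2 t) (at t)"
      using coords(2)[of 0 t] coords(2)[of 1 t] by (simp_all add: numeral_2_eq_2)
    show "(Z 2 has_vector_derivative
        - (\<i> * of_real (2 * Im (cnj (Z 0 t) * Z 1 t) + sqrt 2 * C) * Z 0 t)) (at t)"
      using coords(2)[of 2 t] Z3[of t] by (simp add: numeral_3_eq_3 numeral_2_eq_2)
    show "Z 0 t \<noteq> 0"
      using assms(2)[of t] V[of t] bounded_linear_su2_of_complex[THEN linear_simps(3)] by auto
    show "Re (Z 2 t * cnj (Z 0 t)) - (norm (Z 1 t))\<^sup>2 / 2 > 0"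
      using assms(3)[of t] unfolding lq_c1_def V V1 coords(1) su2_inner_su2_of_complex
      unfolding cmod_power2 by (simp add: power2_eq_square)
  qed
  have q_eq: "q t = norm (Z 0 t)" for t
    by (simp add: q V su2_norm_su2_of_complex)
  obtain A \<Phi> where A: "((\<lambda>t. Z 0 t /\<^sub>R norm (Z 0 t)) \<longlongrightarrow> A) at_top"
    and \<Phi>: "\<And>t. (\<Phi> has_real_derivative - (1 / (2 * u t))) (at t)" "(\<Phi> \<longlongrightarrow> 0) at_top"
    and bound: "(\<lambda>t. norm (Z 0 t - norm (Z 0 t) *\<^sub>R (A + (sqrt 2 * C * \<Phi> t) *\<^sub>R (\<i> * A))))
      \<in> O(\<lambda>t. 1 / t ^ 4)"
    using asymptotics by blast
  have lim: "((\<lambda>t. V t /\<^sub>R su2_norm (V t)) \<longlongrightarrow> su2_of_complex A) at_top"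
    using bounded_linear.tendsto[OF bounded_linear_su2_of_complex A]
    by (simp add: V su2_norm_su2_of_complex
        linear_cmul[OF bounded_linear.linear[OF bounded_linear_su2_of_complex]])
  then have alpha: "alpha_plus V = su2_of_complex A"
    unfolding alpha_plus_def by (intro tendsto_Lim) auto
  have u_q: "u = (\<lambda>t. (q t)\<^sup>2)"
    by (simp add: fun_eq_iff u_eq q_eq)
  have cont: "continuous_on UNIV (\<lambda>t. 1 / (2 * u t))"
    using u_deriv u_pos
    by (intro continuous_intros)
       (auto simp: less_imp_neq[symmetric] intro: DERIV_continuous_on has_field_derivative_at_within)
  \<comment> \<open>This yields integrability and identifies \<open>\<Phi> r\<close> with the tail
    integral of 1 / (2 q^2).\<close>
  note integral = improper_integral_of_nonneg_derivative[OF cont \<Phi>(1) _ \<Phi>(2), unfolded u_q, simplified]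
  define e where "e t = Z 0 t - norm (Z 0 t) *\<^sub>R (A + (sqrt 2 * C * \<Phi> t) *\<^sub>R (\<i> * A))" for t
  have "su2_bigo (\<lambda>t. su2_of_complex (e t)) (\<lambda>r. r powi (- 4))"
  proof -
    obtain K T where "K > 0" "T \<ge> 1" "\<And>t. t \<ge> T \<Longrightarrow> norm (norm (e t)) \<le> K * norm (1 / t ^ 4)"
      using eventually_at_top_bound[OF bound, folded e_def] by blast
    then show ?thesis
      unfolding su2_bigo_def
      by (intro conjI allI su2_of_complex_in_su2 exI[of _ K] eventually_at_top_linorderI[of T])
         (auto simp: su2_norm_su2_of_complex power_int_minus divide_inverse)
  qed
  moreover have "V r = q r *\<^sub>R alpha_plus V - (q r * (LINT t:{r..}|lborel. 1 / (2 * (q t)\<^sup>2)))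
      *\<^sub>R lie_bracket (C_tilde C) (alpha_plus V) + su2_of_complex (e r)" for r
  proof -
    \<comment> \<open>The minus sign in \<open>lie_bracket_C_tilde\<close> accounts for the
      subtraction here, while \<open>asymptotics\<close> has the drift with a plus sign.\<close>
    have "Z 0 r = q r *\<^sub>R A - (q r * \<Phi> r) *\<^sub>R (- (\<i> * of_real (sqrt 2 * C) * A)) + e r"
      by (simp add: e_def q_eq scaleR_conv_of_real algebra_simps)
    then show ?thesis
      unfolding V alpha integral(2) lie_bracket_C_tilde
      by (simp only: linear_simps[OF bounded_linear_su2_of_complex])
  qed
  ultimately show ?thesis
    using lim integral(1) unfolding alpha by blast
qed

end
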